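(* Let $0<\alpha<\beta<\infty$ and $w\in\mathcal W_{\alpha,\beta}$. In total variation, \[ \mathsf Q_{w,r}\longrightarrow\nu_w\otimes\nu_w\quad\text{as }|r|\to\infty,\qquad \mathsf Q_{w,r}\longrightarrow\mathsf Q_{w,0}\quad\text{as }r\to0 . \] The measure $\mathsf Q_{w,0}$ has density \[ \frac{w(y_0)w(y_1)}{\rho_w^{(2)}(0)}\left[\frac{1}{16\pi^2y_0^2y_1^2}-\frac{1}{\pi^2(y_0+y_1)^4}\right] \] with respect to $\mathrm dy_0\,\mathrm dy_1$.
   Context: $\mathcal W_{\alpha,\beta}$ is the set of Borel functions $w:(0,\infty)\to[0,1]$ with $w(y)=0$ for $y\notin[\alpha,\beta]$ and $\int_\alpha^\beta w(y)\,\mathrm dy>0$. Set $\lambda_w=\frac1{4\pi}\int_0^\infty w(y)y^{-2}\,\mathrm dy$, \[ \nu_w(\mathrm dy)=\frac{w(y)y^{-2}\,\mathrm dy}{\int_0^\infty w(u)u^{-2}\,\mathrm du},\qquad \rho_w^{(2)}(r)=\lambda_w^2-\frac1{\pi^2}\int_0^\infty\int_0^\infty\frac{w(y)w(v)}{(r^2+(y+v)^2)^2}\,\mathrm dy\,\mathrm dv>0,\quad r\in\mathbb R . \] For $r\in\mathbb R$, $\mathsf Q_{w,r}$ is the probability measure on $(0,\infty)^2$ \[ \mathsf Q_{w,r}(\mathrm dy_0\,\mathrm dy_1)=\frac{w(y_0)w(y_1)}{\rho_w^{(2)}(r)}\left[\frac{1}{16\pi^2y_0^2y_1^2}-\frac{1}{\pi^2\left(r^2+(y_0+y_1)^2\right)^2}\right]\mathrm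 dy_0\,\mathrm dy_1 . \] *)

theory Defs
  imports "HOL-Analysis.Analysis"
begin

text \<open>
  Functions on \<open>(0,\<infinity>)\<close> are total functions on the reals whose values at non-positive arguments
  are never used: measurability and bounds are only required on \<open>{0<..}\<close>, and all integrals and
  measures live on \<open>{0<..}\<close>.
\<close>

abbreviation pos_lborel :: "real measure" where
  "pos_lborel \<equiv> restrict_space lborel {0<..}"

definition W_class :: "real \<Rightarrow> real \<Rightarrow> (real \<Rightarrow> real) set" where
  "W_class \<alpha> \<beta> = {w.
     w \<in> borel_measurable (restrict_space borel {0<..}) \<and>
     (\<forall>y>0. 0 \<le> w y \<and> w y \<le> 1) \<and>
     (\<forall>y>0. y \<notin> {\<alpha>..\<beta>} \<longrightarrow> w y = 0) \<and>
     (LBINT y:{\<alpha>..\<beta>}. w y) > 0}"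

definition lambda_w :: "(real \<Rightarrow> real) \<Rightarrow> real" where
  "lambda_w w = 1 / (4 * pi) * (LBINT y:{0<..}. w y / y\<^sup>2)"

definition nu_w :: "(real \<Rightarrow> real) \<Rightarrow> real measure" where
  "nu_w w = density pos_lborel
     (\<lambda>y. ennreal (w y / y\<^sup>2 / (LBINT u:{0<..}. w u / u\<^sup>2)))"

definition rho2_w :: "(real \<Rightarrow> real) \<Rightarrow> real \<Rightarrow> real" where
  "rho2_w w r = (lambda_w w)\<^sup>2 -
     1 / pi\<^sup>2 * (LBINT y:{0<..}. LBINT v:{0<..}. w y * w v / (r\<^sup>2 + (y + v)\<^sup>2)\<^sup>2)"

text \<open>
  For \<open>0 < \<alpha> < \<beta>\<close> and \<open>w \<in> W_class \<alpha> \<beta>\<close> one has \<open>rho2_w w r > 0\<close>, and by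
  \<open>(y0 + y1)\<^sup>2 \<ge> 4 y0 y1\<close> the bracket is non-negative, so \<open>ennreal\<close> does not truncate.
\<close>

definition Q_w :: "(real \<Rightarrow> real) \<Rightarrow> real \<Rightarrow> (real \<times> real) measure" where
  "Q_w w r = density (pos_lborel \<Otimes>\<^sub>M pos_lborel)
     (\<lambda>(y0, y1). ennreal (w y0 * w y1 / rho2_w w r *
        (1 / (16 * pi\<^sup>2 * y0\<^sup>2 * y1\<^sup>2) - 1 / (pi\<^sup>2 * (r\<^sup>2 + (y0 + y1)\<^sup>2)\<^sup>2))))"

text \<open>
  Total variation distance, meant for finite measures with the same measurable sets
  (the supremum is then over a bounded set of reals).
\<close>

definition tv_dist :: "'a measure \<Rightarrow> 'a measure \<Rightarrow> real" where
  "tv_dist M N = (SUP A\<in>sets M. \<bar>measure M A - measure N A\<bar>)"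

end

theory Submission
  imports Defs
begin

text \<open>
  The density of \<open>Q_w w r\<close> is \<open>h r\<close> divided by its integral \<open>rho2_w w r\<close>, where
  \<open>h r = w(x) w(y) (a(x, y) - b r (x, y))\<close>, and \<open>nu_w w \<Otimes>\<^sub>M nu_w w\<close> is \<open>w(x) w(y) a(x, y)\<close>
  normalized. Normalizing changes distances by at most a factor \<open>2\<close> over the limiting mass, so only
  \<open>L\<^sup>1\<close> distances between unnormalized densities matter. Since \<open>0 \<le> b r \<le> b 0 \<le> a\<close>, these are
  \<open>B r\<close> and \<open>B 0 - B r\<close>, where \<open>B r\<close> is the integral of \<open>w(x) w(y) b r (x, y)\<close>; they are
  \<open>O(1 / r\<^sup>4)\<close> at infinity and \<open>O(r\<^sup>2)\<close> at \<open>0\<close> because \<open>x, y \<ge> \<alpha>\<close> on the support of the weight.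
\<close>

section \<open>Total variation distance of normalized densities\<close>

lemma measure_density_eq_integral:
  assumes f: "integrable M f" and nn: "\<And>x. x \<in> space M \<Longrightarrow> 0 \<le> f x" and A: "A \<in> sets M"
  shows "measure (density M (\<lambda>x. ennreal (f x))) A = (\<integral>x\<in>A. f x \<partial>M)"
proof -
  have "emeasure (density M (\<lambda>x. ennreal (f x))) A = (\<integral>\<^sup>+x. ennreal (f x) * indicator A x \<partial>M)"
    using f A by (subst emeasure_density) auto
  also have "\<dots> = (\<integral>\<^sup>+x. ennreal (indicator A x * f x) \<partial>M)"
    by (intro nn_integral_cong) (auto simp: indicator_def)
  also have "\<dots> = ennreal (\<integral>x. indicator A x * f x \<partial>M)"
    using integrable_mult_indicator[OF A f] nn
    by (intro nn_integral_eq_integral) (auto simp: indicator_def intro!: AE_I2)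
  finally show ?thesis
    using nn by (auto simp: measure_def set_lebesgue_integral_def intro!: integral_nonneg_AE AE_I2)
qed

lemma abs_set_integral_diff_le:
  fixes h g :: "'a \<Rightarrow> real"
  assumes h: "integrable M h" and g: "integrable M g" and A: "A \<in> sets M"
  shows "\<bar>(\<integral>x\<in>A. h x \<partial>M) - (\<integral>x\<in>A. g x \<partial>M)\<bar> \<le> (\<integral>x. \<bar>h x - g x\<bar> \<partial>M)"
proof -
  have i: "integrable M (\<lambda>x. indicator A x * h x)" "integrable M (\<lambda>x. indicator A x * g x)"
    using integrable_mult_indicator[OF A h] integrable_mult_indicator[OF A g] by auto
  have "(\<integral>x\<in>A. h x \<partial>M) - (\<integral>x\<in>A. g x \<partial>M) = (\<integral>x. indicator A x * h x - indicator A x * g x \<partial>M)"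
    using i by (simp add: set_lebesgue_integral_def)
  also have "\<bar>\<dots>\<bar> \<le> (\<integral>x. \<bar>indicator A x * h x - indicator A x * g x\<bar> \<partial>M)"
    by (rule integral_abs_bound)
  also have "\<dots> \<le> (\<integral>x. \<bar>h x - g x\<bar> \<partial>M)"
    using i h g by (intro integral_mono) (auto simp: indicator_def)
  finally show ?thesis .
qed

text \<open>The uniform bound \<open>C\<close> makes the supremum one over a bounded set, so the
  value 0 at the empty set lies below it.\<close>

lemma tv_dist_nonneg:
  assumes "\<And>A. A \<in> sets M \<Longrightarrow> \<bar>measure M A - measure N A\<bar> \<le> C"
  shows "0 \<le> tv_dist M N"
proof -
  have "\<bar>measure M {} - measure N {}\<bar> \<le> tv_dist M N"
    unfolding tv_dist_def using assms by (intro cSUP_upper bdd_aboveI2) auto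
  then show ?thesis by simp
qed

lemma tv_dist_normalized_densities:
  fixes h g :: "'a \<Rightarrow> real"
  assumes h: "integrable M h" "\<And>x. x \<in> space M \<Longrightarrow> 0 \<le> h x" and H: "0 < (\<integral>x. h x \<partial>M)"
    and g: "integrable M g" "\<And>x. x \<in> space M \<Longrightarrow> 0 \<le> g x" and G: "0 < (\<integral>x. g x \<partial>M)"
  defines "P \<equiv> density M (\<lambda>x. ennreal (h x / (\<integral>x. h x \<partial>M)))"
    and "Q \<equiv> density M (\<lambda>x. ennreal (g x / (\<integral>x. g x \<partial>M)))"
  shows "0 \<le> tv_dist P Q"
    and "tv_dist P Q \<le> 2 * (\<integral>x. \<bar>h x - g x\<bar> \<partial>M) / (\<integral>x. g x \<partial>M)"
proof -
  define IH IG D where "IH = (\<integral>x. h x \<partial>M)" and "IG = (\<integral>x. g x \<partial>M)"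
    and "D = (\<integral>x. \<bar>h x - g x\<bar> \<partial>M)"
  have pos: "0 < IH" "0 < IG" using H G by (auto simp: IH_def IG_def)
  have main: "\<bar>measure P A - measure Q A\<bar> \<le> 2 * D / IG" if "A \<in> sets P" for A
  proof -
    have A: "A \<in> sets M" using that by (simp add: P_def)
    define a b where "a = (\<integral>x\<in>A. h x \<partial>M)" and "b = (\<integral>x\<in>A. g x \<partial>M)"
    have mP: "measure P A = a / IH"
      unfolding P_def a_def IH_def[symmetric] using h pos A
      by (subst measure_density_eq_integral) (auto simp: set_lebesgue_integral_def)
    have mQ: "measure Q A = b / IG"
      unfolding Q_def b_def IG_def[symmetric] using g pos A
      by (subst measure_density_eq_integral) (auto simp: set_lebesgue_integral_def)
    have ab: "\<bar>a - b\<bar> \<le> D"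
      unfolding a_def b_def D_def by (rule abs_set_integral_diff_le) fact+
    \<comment> \<open>The total masses are compared by taking the whole space as the set.\<close>
    have HG: "\<bar>IG - IH\<bar> \<le> D"
      using abs_set_integral_diff_le[OF h(1) g(1) sets.top]
      by (simp add: set_integral_space h g IH_def IG_def D_def abs_minus_commute)
    have a0: "0 \<le> a" unfolding a_def set_lebesgue_integral_def using h(2)
      by (intro integral_nonneg_AE AE_I2) (auto simp: indicator_def)
    have aH: "a \<le> IH" unfolding a_def set_lebesgue_integral_def IH_def
      using h A integrable_mult_indicator[OF A h(1)]
      by (intro integral_mono) (auto simp: indicator_def)
    \<comment> \<open>This splitting leaves only \<open>IG\<close> as outer denominator:
      \<open>IH\<close> survives in the ratio \<open>a / IH\<close>, which is at most 1. One
      \<open>D\<close> pays for the change of mass and one for the change of numerator, hence the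
      factor 2.\<close>
    have "a / IH - b / IG = (a / IH * (IG - IH) + (a - b)) / IG"
      using pos by (simp add: field_simps)
    also have "\<bar>\<dots>\<bar> = \<bar>a / IH * (IG - IH) + (a - b)\<bar> / IG"
      using pos by simp
    also have "\<dots> \<le> (1 * D + D) / IG"
    proof (intro divide_right_mono order_trans[OF abs_triangle_ineq] add_mono ab)
      show "\<bar>a / IH * (IG - IH)\<bar> \<le> 1 * D"
        unfolding abs_mult using a0 aH pos HG by (intro mult_mono) auto
    qed (use pos in auto)
    finally show ?thesis unfolding mP mQ by simp
  qed
  show "0 \<le> tv_dist P Q" using main by (rule tv_dist_nonneg)
  show "tv_dist P Q \<le> 2 * (\<integral>x. \<bar>h x - g x\<bar> \<partial>M) / (\<integral>x. g x \<partial>M)"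
    unfolding tv_dist_def D_def[symmetric] IG_def[symmetric]
    using main by (intro cSUP_least) auto
qed

section \<open>Lebesgue measure on the half-line and on its square\<close>

lemma set_integral_pos_lborel: "(LBINT y:{0<..}. f y) = (\<integral>y. f y \<partial>pos_lborel)"
  for f :: "real \<Rightarrow> real"
  by (simp add: set_lebesgue_integral_def integral_restrict_space)

lemma sigma_finite_pos_lborel: "sigma_finite_measure pos_lborel"
  by (intro sigma_finite_measure_restrict_space sigma_finite_lborel) auto

interpretation pos_lborel: sigma_finite_measure pos_lborel
  by (rule sigma_finite_pos_lborel)

interpretation pos_lborel_pair: pair_sigma_finite pos_lborel pos_lborel ..

abbreviation pos_lborel2 :: "(real \<times> real) measure" where
  "pos_lborel2 \<equiv> pos_lborel \<Otimes>\<^sub>M pos_lborel"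

lemma space_pos_lborel2: "space pos_lborel2 = {0<..} \<times> {0<..}"
  by (simp add: space_pair_measure space_restrict_space)

text \<open>Sectionwise form of the diagonal being a null set: over each first coordinate
  \<open>c\<close> it has a single point.\<close>

lemma AE_pos_lborel_neq: "AE y in pos_lborel. y \<noteq> c"
  using AE_lborel_singleton[of c] by (subst AE_restrict_space_iff) (auto elim: eventually_mono)

section \<open>The two kernels: comparison, decay and behaviour near r = 0\<close>

definition kern_a :: "real \<times> real \<Rightarrow> real" where
  "kern_a p = 1 / (16 * pi\<^sup>2 * (fst p)\<^sup>2 * (snd p)\<^sup>2)"

definition kern_b :: "real \<Rightarrow> real \<times> real \<Rightarrow> real" where
  "kern_b r p = 1 / (pi\<^sup>2 * (r\<^sup>2 + (fst p + snd p)\<^sup>2)\<^sup>2)"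

lemma fst_measurable [measurable]: "fst \<in> borel_measurable pos_lborel2"
  by (rule measurable_compose[OF measurable_fst, of "\<lambda>x. x", simplified])
     (simp add: measurable_restrict_space1)

lemma snd_measurable [measurable]: "snd \<in> borel_measurable pos_lborel2"
  by (rule measurable_compose[OF measurable_snd, of "\<lambda>x. x", simplified])
     (simp add: measurable_restrict_space1)

lemma kern_a_measurable [measurable]: "kern_a \<in> borel_measurable pos_lborel2"
  unfolding kern_a_def by measurable

lemma kern_b_measurable [measurable]: "kern_b r \<in> borel_measurable pos_lborel2"
  unfolding kern_b_def by measurable

lemma kern_b_nonneg: "0 \<le> kern_b r p"
  by (simp add: kern_b_def)

lemma kern_a_nonneg: "0 \<le> kern_a p"
  by (simp add: kern_a_def)

lemma kern_b_antimono:
  assumes "0 < x" "0 < y"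
  shows "kern_b r (x, y) \<le> kern_b 0 (x, y)"
proof -
  have "((x + y)\<^sup>2)\<^sup>2 \<le> (r\<^sup>2 + (x + y)\<^sup>2)\<^sup>2"
    by (intro power_mono) auto
  then show ?thesis using assms
    by (auto simp: kern_b_def intro!: divide_left_mono mult_left_mono mult_pos_pos
        zero_less_power add_nonneg_pos)
qed

text \<open>The numerator (x + y)^4 - (4xy)^2 is a difference of squares, and (x + y)^2 - 4xy = (x -
  y)^2. The factored form displays both the sign and the zero set.\<close>

lemma kern_a_diff_kern_b_0:
  assumes "0 < x" "0 < y"
  shows "kern_a (x, y) - kern_b 0 (x, y) =
    (x - y)\<^sup>2 * ((x + y)\<^sup>2 + 4 * x * y) / (16 * pi\<^sup>2 * x\<^sup>2 * y\<^sup>2 * (x + y) ^ 4)"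
proof -
  have *: "1 / (16 * q * X) - 1 / (q * Y) = (Y - 16 * X) / (16 * q * X * Y)"
    if "q > 0" "X > 0" "Y > 0" for q X Y :: real
    using that by (simp add: field_simps)
  have "kern_a (x, y) - kern_b 0 (x, y) =
      1 / (16 * pi\<^sup>2 * (x\<^sup>2 * y\<^sup>2)) - 1 / (pi\<^sup>2 * (x + y) ^ 4)"
    by (simp add: kern_a_def kern_b_def mult.assoc flip: power_mult)
  also have "\<dots> = ((x + y) ^ 4 - 16 * (x\<^sup>2 * y\<^sup>2)) / (16 * pi\<^sup>2 * (x\<^sup>2 * y\<^sup>2) * (x + y) ^ 4)"
    using assms by (intro *) auto
  also have "(x + y) ^ 4 - 16 * (x\<^sup>2 * y\<^sup>2) = (x - y)\<^sup>2 * ((x + y)\<^sup>2 + 4 * x * y)"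
    by algebra
  finally show ?thesis by (simp add: mult.assoc)
qed

lemma kern_b_le_kern_a:
  assumes "0 < x" "0 < y"
  shows "kern_b r (x, y) \<le> kern_a (x, y)"
proof -
  have "0 \<le> kern_a (x, y) - kern_b 0 (x, y)"
    using assms by (subst kern_a_diff_kern_b_0) auto
  with kern_b_antimono[OF assms, of r] show ?thesis by linarith
qed

text \<open>Only the factor (x - y)^2 of the difference can vanish. This strictness off the diagonal
  yields the positivity of \<open>rho2_w w 0\<close>.\<close>

lemma kern_b_0_eq_kern_a_iff:
  assumes "0 < x" "0 < y"
  shows "kern_b 0 (x, y) = kern_a (x, y) \<longleftrightarrow> x = y"
proof -
  have "(x + y)\<^sup>2 + 4 * x * y > 0" using assms by (intro add_pos_pos) auto
  then show ?thesis using kern_a_diff_kern_b_0[OF assms] assms by auto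
qed

text \<open>Dropping the square of the sum and using pi^2 \<ge> 1 leaves 1 / r^4, uniformly in the
  point.\<close>

lemma kern_b_decay:
  assumes "r \<noteq> 0"
  shows "kern_b r p \<le> (inverse r) ^ 4"
proof -
  have "r ^ 4 = (r\<^sup>2)\<^sup>2" by simp
  also have "\<dots> \<le> (r\<^sup>2 + (fst p + snd p)\<^sup>2)\<^sup>2" by (intro power_mono) auto
  also have "\<dots> \<le> pi\<^sup>2 * \<dots>"
    using pi_gt3 by (simp add: mult_le_cancel_right1)
  finally have "r ^ 4 \<le> pi\<^sup>2 * (r\<^sup>2 + (fst p + snd p)\<^sup>2)\<^sup>2" .
  moreover have "0 < r ^ 4" using assms by simp
  ultimately have "kern_b r p \<le> 1 / r ^ 4"
    unfolding kern_b_def by (intro divide_left_mono mult_pos_pos) auto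
  then show ?thesis by (simp add: field_simps)
qed

text \<open>With s = (x + y)^2 and t = r^2 the difference is of order t / s^3, and the lower bound
  \<open>c\<close> on x + y makes this uniform; s^3 \<ge> c^6 accounts for the sixth power.\<close>

lemma kern_b_0_diff_le:
  assumes "0 < c" "c \<le> x + y"
  shows "kern_b 0 (x, y) - kern_b r (x, y) \<le> 2 * r\<^sup>2 / (pi\<^sup>2 * c ^ 6)"
proof -
  define s where "s = (x + y)\<^sup>2"
  define t where "t = r\<^sup>2"
  have s: "0 < s" and t: "0 \<le> t" using assms by (auto simp: s_def t_def)
  have cs: "c ^ 6 \<le> s ^ 3"
    using power_mono[of c "x + y" 6] assms by (simp add: s_def flip: power_mult)
  have ts: "0 < t + s" using s t by simp
  have "1 / s\<^sup>2 - 1 / (t + s)\<^sup>2 = t * (t + 2 * s) / (s\<^sup>2 * (t + s)\<^sup>2)"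
    using s ts by (simp add: field_simps) (simp add: power2_eq_square algebra_simps)
  \<comment> \<open>Enlarging t + 2s to 2(t + s) cancels one factor of the denominator.\<close>
  also have "\<dots> \<le> t * (2 * (t + s)) / (s\<^sup>2 * (t + s)\<^sup>2)"
    using s t by (intro divide_right_mono mult_left_mono) auto
  also have "\<dots> = 2 * t / (s\<^sup>2 * (t + s))"
    using ts by (simp add: power2_eq_square[of "t + s"] del: distrib_left_numeral)
  also have "\<dots> \<le> 2 * t / s ^ 3"
    using s t by (intro divide_left_mono) (auto simp: power2_eq_square power3_eq_cube)
  also have "\<dots> \<le> 2 * t / c ^ 6"
    using cs t assms s by (intro divide_left_mono) auto
  finally have "(1 / s\<^sup>2 - 1 / (t + s)\<^sup>2) / pi\<^sup>2 \<le> 2 * t / c ^ 6 / pi\<^sup>2"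
    by (rule divide_right_mono) simp
  then show ?thesis
    by (simp add: kern_b_def s_def t_def diff_divide_distrib mult.commute)
qed

section \<open>Integrability and integrals of the weighted kernels\<close>

locale weight =
  fixes \<alpha> \<beta> :: real and w :: "real \<Rightarrow> real"
  assumes \<alpha>_pos: "0 < \<alpha>" and w_class: "w \<in> W_class \<alpha> \<beta>"
begin

lemma w_measurable [measurable]: "w \<in> borel_measurable pos_lborel"
  using w_class unfolding W_class_def
  by (simp cong: measurable_cong_sets sets_restrict_space_cong)

lemma w_nonneg: "0 < y \<Longrightarrow> 0 \<le> w y"
  and w_le_1: "0 < y \<Longrightarrow> w y \<le> 1"
  and w_support: "0 < y \<Longrightarrow> w y \<noteq> 0 \<Longrightarrow> \<alpha> \<le> y \<and> y \<le> \<beta>"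
  using w_class by (auto simp: W_class_def)

definition ww :: "real \<times> real \<Rightarrow> real" where
  "ww p = w (fst p) * w (snd p)"

lemma ww_measurable [measurable]: "ww \<in> borel_measurable pos_lborel2"
  unfolding ww_def by measurable

lemma ww_nonneg: "p \<in> space pos_lborel2 \<Longrightarrow> 0 \<le> ww p"
  by (auto simp: ww_def space_pos_lborel2 w_nonneg)

lemma ww_support:
  assumes "p \<in> space pos_lborel2" "ww p \<noteq> 0"
  shows "p \<in> {\<alpha>..\<beta>} \<times> {\<alpha>..\<beta>}"
  using assms by (cases p) (auto simp: ww_def space_pos_lborel2 dest: w_support)

text \<open>The weight is at most 1 and is supported in a square of finite measure. The bound is
  asked only for coordinates at least \<alpha>, which keeps away from the singularity of
  \<open>kern_a\<close> at the axes.\<close>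

lemma integrable_if_bounded_on_support:
  fixes f :: "real \<times> real \<Rightarrow> real"
  assumes [measurable]: "f \<in> borel_measurable pos_lborel2"
    and bnd: "\<And>x y. \<alpha> \<le> x \<Longrightarrow> \<alpha> \<le> y \<Longrightarrow> \<bar>f (x, y)\<bar> \<le> C"
  shows "integrable pos_lborel2 (\<lambda>p. ww p * f p)"
proof (rule integrableI_bounded_set)
  have I: "{\<alpha>..\<beta>} \<in> sets pos_lborel"
    using \<alpha>_pos by (auto simp: sets_restrict_space_iff)
  then show "{\<alpha>..\<beta>} \<times> {\<alpha>..\<beta>} \<in> sets pos_lborel2" by auto
  have "emeasure pos_lborel {\<alpha>..\<beta>} = emeasure lborel {\<alpha>..\<beta>}"
    using \<alpha>_pos by (intro emeasure_restrict_space) auto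
  then have "emeasure pos_lborel {\<alpha>..\<beta>} < \<infinity>" by (simp add: emeasure_lborel_Icc_eq)
  then show "emeasure pos_lborel2 ({\<alpha>..\<beta>} \<times> {\<alpha>..\<beta>}) < \<infinity>"
    using I by (simp add: pos_lborel.emeasure_pair_measure_Times ennreal_mult_less_top)
  show "AE p in pos_lborel2. p \<in> {\<alpha>..\<beta>} \<times> {\<alpha>..\<beta>} \<longrightarrow> norm (ww p * f p) \<le> 1 * C"
  proof (intro AE_I2 impI)
    fix p :: "real \<times> real" assume p: "p \<in> {\<alpha>..\<beta>} \<times> {\<alpha>..\<beta>}"
    obtain x y where [simp]: "p = (x, y)" by (cases p)
    have "\<bar>w x\<bar> \<le> 1" "\<bar>w y\<bar> \<le> 1" "0 < x" "0 < y"
      using p \<alpha>_pos w_nonneg[of x] w_nonneg[of y] w_le_1[of x] w_le_1[of y] by auto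
    then have "\<bar>ww p\<bar> \<le> 1" by (auto simp: ww_def abs_mult intro: mult_le_one)
    then show "norm (ww p * f p) \<le> 1 * C"
      using bnd[of x y] p unfolding real_norm_def abs_mult by (intro mult_mono) auto
  qed
  show "AE p in pos_lborel2. p \<notin> {\<alpha>..\<beta>} \<times> {\<alpha>..\<beta>} \<longrightarrow> ww p * f p = 0"
    using ww_support by (intro AE_I2) fastforce
qed measurable

lemma ww_integrable: "integrable pos_lborel2 ww"
  using integrable_if_bounded_on_support[of "\<lambda>_. 1" 1] by simp

lemma ww_kern_a_integrable: "integrable pos_lborel2 (\<lambda>p. ww p * kern_a p)"
proof (rule integrable_if_bounded_on_support)
  fix x y :: real assume "\<alpha> \<le> x" "\<alpha> \<le> y"
  \<comment> \<open>\<open>kern_a\<close> decreases in each coordinate, so its bound is the value at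
    the corner (\<alpha>, \<alpha>).\<close>
  then have "\<alpha>\<^sup>2 * \<alpha>\<^sup>2 \<le> x\<^sup>2 * y\<^sup>2" using \<alpha>_pos by (intro mult_mono power_mono) auto
  then have "kern_a (x, y) \<le> 1 / (16 * pi\<^sup>2 * (\<alpha>\<^sup>2 * \<alpha>\<^sup>2))"
    unfolding kern_a_def using \<open>\<alpha> \<le> x\<close> \<open>\<alpha> \<le> y\<close> \<alpha>_pos
    by (auto simp: mult.assoc intro!: divide_left_mono mult_left_mono)
  then show "\<bar>kern_a (x, y)\<bar> \<le> 1 / (16 * pi\<^sup>2 * (\<alpha>\<^sup>2 * \<alpha>\<^sup>2))"
    using kern_a_nonneg by simp
qed measurable

text \<open>Domination by \<open>kern_a\<close> handles every r at once.\<close>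

lemma ww_kern_b_integrable: "integrable pos_lborel2 (\<lambda>p. ww p * kern_b r p)"
proof (rule Bochner_Integration.integrable_bound[OF ww_kern_a_integrable])
  show "AE p in pos_lborel2. norm (ww p * kern_b r p) \<le> norm (ww p * kern_a p)"
    using kern_b_le_kern_a kern_b_nonneg kern_a_nonneg
    by (intro AE_I2) (auto simp: abs_mult space_pos_lborel2 intro!: mult_left_mono)
qed measurable

definition Bint :: "real \<Rightarrow> real" where
  "Bint r = (\<integral>p. ww p * kern_b r p \<partial>pos_lborel2)"

definition pair_density :: "real \<Rightarrow> real \<times> real \<Rightarrow> real" where
  "pair_density r p = ww p * (kern_a p - kern_b r p)"

lemma pair_density_integrable: "integrable pos_lborel2 (pair_density r)"
  unfolding pair_density_def right_diff_distrib
  by (intro Bochner_Integration.integrable_diff ww_kern_a_integrable ww_kern_b_integrable)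

lemma pair_density_nonneg: "p \<in> space pos_lborel2 \<Longrightarrow> 0 \<le> pair_density r p"
  unfolding pair_density_def using ww_nonneg kern_b_le_kern_a by (cases p) (auto simp: space_pos_lborel2)

text \<open>\<open>kern_a\<close> is the product of 1 / (4 pi x^2) and 1 / (4 pi y^2), so by Fubini
  the integral factors into two copies of \<open>lambda_w w\<close>.\<close>

lemma integral_ww_kern_a: "(\<integral>p. ww p * kern_a p \<partial>pos_lborel2) = (lambda_w w)\<^sup>2"
proof -
  define I where "I = (\<integral>y. w y / y\<^sup>2 \<partial>pos_lborel)"
  have "(\<integral>p. ww p * kern_a p \<partial>pos_lborel2)
      = (\<integral>x. \<integral>y. ww (x, y) * kern_a (x, y) \<partial>pos_lborel \<partial>pos_lborel)"
    by (rule pos_lborel_pair.integral_fst'[symmetric]) (rule ww_kern_a_integrable)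
  also have "\<dots> = (\<integral>x. \<integral>y. (1 / (16 * pi\<^sup>2) * (w x / x\<^sup>2)) * (w y / y\<^sup>2) \<partial>pos_lborel \<partial>pos_lborel)"
    by (simp add: ww_def kern_a_def)
  also have "\<dots> = 1 / (16 * pi\<^sup>2) * I * I"
    unfolding I_def by (simp only: integral_mult_right_zero integral_mult_left_zero)
  also have "\<dots> = (lambda_w w)\<^sup>2"
    unfolding lambda_w_def set_integral_pos_lborel I_def[symmetric]
    by (simp add: power2_eq_square)
  finally show ?thesis .
qed

lemma rho2_w_eq: "rho2_w w r = (lambda_w w)\<^sup>2 - Bint r"
proof -
  have "Bint r = (\<integral>x. \<integral>y. ww (x, y) * kern_b r (x, y) \<partial>pos_lborel \<partial>pos_lborel)"
    unfolding Bint_def by (rule pos_lborel_pair.integral_fst'[symmetric]) (rule ww_kern_b_integrable)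
  also have "\<dots> = (\<integral>x. \<integral>y. 1 / pi\<^sup>2 * (w x * w y / (r\<^sup>2 + (x + y)\<^sup>2)\<^sup>2) \<partial>pos_lborel \<partial>pos_lborel)"
    by (simp add: ww_def kern_b_def)
  also have "\<dots> = 1 / pi\<^sup>2 * (\<integral>x. \<integral>y. w x * w y / (r\<^sup>2 + (x + y)\<^sup>2)\<^sup>2 \<partial>pos_lborel \<partial>pos_lborel)"
    by (simp only: integral_mult_right_zero)
  finally show ?thesis unfolding rho2_w_def set_integral_pos_lborel by simp
qed

lemma integral_pair_density: "(\<integral>p. pair_density r p \<partial>pos_lborel2) = rho2_w w r"
  unfolding pair_density_def right_diff_distrib rho2_w_eq Bint_def
  using ww_kern_a_integrable ww_kern_b_integrable integral_ww_kern_a by simp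

section \<open>Positivity of the normalizing constants\<close>

lemma not_AE_w_zero: "\<not> (AE y in pos_lborel. w y = 0)"
proof
  assume "AE y in pos_lborel. w y = 0"
  then have "AE y in lborel. 0 < y \<longrightarrow> w y = 0" by (subst (asm) AE_restrict_space_iff) auto
  then have "AE y in lborel. indicator {\<alpha>..\<beta>} y *\<^sub>R w y = 0"
    by (rule AE_mp) (use \<alpha>_pos in \<open>auto simp: indicator_def intro!: AE_I2\<close>)
  then have "(LBINT y:{\<alpha>..\<beta>}. w y) = 0"
    unfolding set_lebesgue_integral_def by (rule integral_eq_zero_AE)
  with w_class show False by (simp add: W_class_def)
qed

text \<open>Away from the diagonal, which is a null set, \<open>pair_density 0\<close> vanishes only where the weight does.\<close>

lemma rho2_w_0_pos: "0 < rho2_w w 0"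
proof (rule ccontr)
  assume "\<not> 0 < rho2_w w 0"
  moreover have "0 \<le> (\<integral>p. pair_density 0 p \<partial>pos_lborel2)"
    by (intro integral_nonneg_AE AE_I2 pair_density_nonneg)
  ultimately have "(\<integral>p. pair_density 0 p \<partial>pos_lborel2) = 0" by (simp add: integral_pair_density)
  then have "AE p in pos_lborel2. pair_density 0 p = 0"
    using integral_nonneg_eq_0_iff_AE[OF pair_density_integrable[of 0]] pair_density_nonneg by (auto intro: AE_I2)
  then have "AE x in pos_lborel. AE y in pos_lborel. pair_density 0 (x, y) = 0"
    by (rule pos_lborel_pair.AE_pair)
  \<comment> \<open>A single such x with \<open>w x\<close> nonzero would force
    \<open>w y = 0\<close> for almost every y different from x, which is already excluded. Hence
    \<open>w\<close> vanishes at almost every x, the same contradiction again.\<close>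
  then have "AE x in pos_lborel. w x = 0"
    using AE_space
  proof eventually_elim
    case (elim x)
    show "w x = 0"
    proof (rule ccontr)
      assume "w x \<noteq> 0"
      have "AE y in pos_lborel. w y = 0"
        using elim(1) AE_pos_lborel_neq[of x] AE_space
      proof eventually_elim
        case (elim y)
        then show ?case
          using \<open>x \<in> space pos_lborel\<close> \<open>w x \<noteq> 0\<close> kern_b_0_eq_kern_a_iff[of x y]
          by (auto simp: pair_density_def ww_def space_restrict_space)
      qed
      with not_AE_w_zero show False ..
    qed
  qed
  with not_AE_w_zero show False ..
qed

lemma Bint_antimono: "Bint r \<le> Bint 0"
  unfolding Bint_def
  using kern_b_antimono ww_nonneg
  by (intro integral_mono ww_kern_b_integrable) (auto simp: space_pos_lborel2 intro!: mult_left_mono)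

lemma Bint_nonneg: "0 \<le> Bint r"
  unfolding Bint_def using ww_nonneg kern_b_nonneg by (intro integral_nonneg_AE AE_I2) auto

text \<open>The subtracted term is largest at r = 0, so positivity there carries over to every
  r.\<close>

lemma rho2_w_pos: "0 < rho2_w w r"
  using rho2_w_0_pos Bint_antimono[of r] by (simp add: rho2_w_eq)

lemma lambda_w_sq_pos: "0 < (lambda_w w)\<^sup>2"
  using rho2_w_0_pos Bint_nonneg[of 0] unfolding rho2_w_eq by linarith

section \<open>Limits of \<open>Bint\<close> at infinity and at 0\<close>

lemma Bint_at_infinity: "(Bint \<longlongrightarrow> 0) at_infinity"
proof (rule tendsto_sandwich[where f = "\<lambda>_. 0"])
  define K where "K = (\<integral>p. ww p \<partial>pos_lborel2)"
  show "\<forall>\<^sub>F r in at_infinity. Bint r \<le> K * (inverse r) ^ 4"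
    using eventually_not_equal_at_infinity[of 0]
  proof eventually_elim
    case (elim r)
    have "Bint r \<le> (\<integral>p. ww p * (inverse r) ^ 4 \<partial>pos_lborel2)"
      unfolding Bint_def using kern_b_decay[OF elim] ww_nonneg ww_integrable
      by (intro integral_mono ww_kern_b_integrable) (auto intro!: mult_left_mono)
    then show ?case by (simp add: K_def)
  qed
  have "((\<lambda>r. K * (inverse r) ^ 4) \<longlongrightarrow> K * 0 ^ 4) (at_infinity :: real filter)"
    by (intro tendsto_intros tendsto_inverse_0)
  then show "((\<lambda>r. K * (inverse r) ^ 4) \<longlongrightarrow> 0) (at_infinity :: real filter)" by simp
qed (auto simp: Bint_nonneg)

lemma Bint_at_0: "(Bint \<longlongrightarrow> Bint 0) (at 0)"
proof (rule tendsto_sandwich)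
  define K where "K = (\<integral>p. ww p \<partial>pos_lborel2)"
  \<comment> \<open>The constant of \<open>kern_b_0_diff_le\<close> for c = 2\<alpha>, the lower
    bound for x + y where the weight is nonzero.\<close>
  define C where "C = 2 / (pi\<^sup>2 * (2 * \<alpha>) ^ 6)"
  have "Bint 0 - Bint r \<le> K * (C * r\<^sup>2)" for r
  proof -
    have "Bint 0 - Bint r = (\<integral>p. ww p * kern_b 0 p - ww p * kern_b r p \<partial>pos_lborel2)"
      unfolding Bint_def using ww_kern_b_integrable by simp
    also have "\<dots> \<le> (\<integral>p. ww p * (C * r\<^sup>2) \<partial>pos_lborel2)"
    proof (intro integral_mono)
      fix p assume p: "p \<in> space pos_lborel2"
      show "ww p * kern_b 0 p - ww p * kern_b r p \<le> ww p * (C * r\<^sup>2)"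
      proof (cases "ww p = 0")
        case False
        obtain x y where [simp]: "p = (x, y)" by (cases p)
        have "2 * \<alpha> \<le> x + y" using ww_support[OF p False] by auto
        then have "kern_b 0 p - kern_b r p \<le> C * r\<^sup>2"
          using kern_b_0_diff_le[of "2 * \<alpha>" x y r] \<alpha>_pos by (simp add: C_def)
        then show ?thesis
          using ww_nonneg[OF p] by (auto simp flip: right_diff_distrib intro!: mult_left_mono)
      qed simp
    qed (use ww_kern_b_integrable ww_integrable in auto)
    finally show ?thesis by (simp add: K_def)
  qed
  then show "\<forall>\<^sub>F r in at 0. Bint 0 - K * (C * r\<^sup>2) \<le> Bint r"
    by (intro always_eventually allI) (simp add: algebra_simps)
  have "((\<lambda>r. Bint 0 - K * (C * r\<^sup>2)) \<longlongrightarrow> Bint 0 - K * (C * 0\<^sup>2)) (at 0)"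
    by (intro tendsto_intros)
  then show "((\<lambda>r. Bint 0 - K * (C * r\<^sup>2)) \<longlongrightarrow> Bint 0) (at 0)" by simp
qed (auto simp: Bint_antimono)

section \<open>The measures as normalized densities on the square\<close>

lemma Q_w_eq:
  "Q_w w r = density pos_lborel2 (\<lambda>p. ennreal (pair_density r p / (\<integral>p. pair_density r p \<partial>pos_lborel2)))"
  unfolding Q_w_def integral_pair_density
  by (intro arg_cong2[where f = density] refl)
     (auto simp: fun_eq_iff pair_density_def ww_def kern_a_def kern_b_def)

text \<open>A product of densities is the density of the product. The factor 1 / (16 pi^2) in
  \<open>kern_a\<close> cancels against the one in the square of \<open>lambda_w w\<close>.\<close>

lemma nu_w_pair_eq:
  "nu_w w \<Otimes>\<^sub>M nu_w w = density pos_lborel2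
     (\<lambda>p. ennreal (ww p * kern_a p / (\<integral>p. ww p * kern_a p \<partial>pos_lborel2)))"
proof -
  define I where "I = (\<integral>y. w y / y\<^sup>2 \<partial>pos_lborel)"
  define f where "f = (\<lambda>y. ennreal (w y / y\<^sup>2 / I))"
  have [measurable]: "(\<lambda>y::real. y) \<in> borel_measurable pos_lborel"
    by (simp add: measurable_restrict_space1)
  have f[measurable]: "f \<in> borel_measurable pos_lborel"
    unfolding f_def by measurable
  have nu: "nu_w w = density pos_lborel f"
    unfolding nu_w_def f_def set_integral_pos_lborel I_def ..
  \<comment> \<open>A density over a sigma-finite measure is sigma-finite when it is finite almost
    everywhere, and \<open>f\<close> takes only values \<open>ennreal\<close> of reals.\<close>
  have sf: "sigma_finite_measure (density pos_lborel f)"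
    using f by (subst pos_lborel.sigma_finite_iff_density_finite) (auto simp: f_def)
  \<comment> \<open>The sign is used below, where \<open>ennreal\<close> is multiplicative for
    nonnegative factors.\<close>
  have I: "0 \<le> I" unfolding I_def
    by (intro integral_nonneg_AE AE_I2) (auto simp: space_restrict_space w_nonneg)
  have lam: "(lambda_w w)\<^sup>2 = I\<^sup>2 / (16 * pi\<^sup>2)"
    unfolding lambda_w_def set_integral_pos_lborel I_def[symmetric]
    by (simp add: power_divide power_mult_distrib)
  have "nu_w w \<Otimes>\<^sub>M nu_w w = density pos_lborel2 (\<lambda>(x, y). f x * f y)"
    unfolding nu by (intro pair_measure_density f sf sigma_finite_pos_lborel)
  also have "\<dots> = density pos_lborel2 (\<lambda>p. ennreal (ww p * kern_a p / (lambda_w w)\<^sup>2))"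
  proof (intro density_cong AE_I2)
    fix p assume "p \<in> space pos_lborel2"
    then obtain x y where p: "p = (x, y)" "0 < x" "0 < y" by (auto simp: space_pos_lborel2)
    have "f x * f y = ennreal ((w x / x\<^sup>2 / I) * (w y / y\<^sup>2 / I))"
      unfolding f_def using p I w_nonneg by (intro ennreal_mult[symmetric]) auto
    also have "(w x / x\<^sup>2 / I) * (w y / y\<^sup>2 / I) = ww p * kern_a p / (lambda_w w)\<^sup>2"
      unfolding lam using p by (simp add: ww_def kern_a_def power2_eq_square)
    finally show "(case p of (x, y) \<Rightarrow> f x * f y) = ennreal (ww p * kern_a p / (lambda_w w)\<^sup>2)"
      by (simp add: p)
  qed measurable
  finally show ?thesis unfolding integral_ww_kern_a .
qed

section \<open>Total variation bounds and the two limits\<close>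

lemma tv_dist_Q_w_nu_w:
  "0 \<le> tv_dist (Q_w w r) (nu_w w \<Otimes>\<^sub>M nu_w w)"
  "tv_dist (Q_w w r) (nu_w w \<Otimes>\<^sub>M nu_w w) \<le> 2 * Bint r / (lambda_w w)\<^sup>2"
proof -
  have "\<bar>pair_density r p - ww p * kern_a p\<bar> = ww p * kern_b r p" if "p \<in> space pos_lborel2" for p
    using ww_nonneg[OF that] kern_b_nonneg[of r p] by (simp add: pair_density_def algebra_simps)
  then have B: "(\<integral>p. \<bar>pair_density r p - ww p * kern_a p\<bar> \<partial>pos_lborel2) = Bint r"
    unfolding Bint_def by (intro Bochner_Integration.integral_cong) auto
  have nn: "0 \<le> ww p * kern_a p" if "p \<in> space pos_lborel2" for p
    using ww_nonneg[OF that] kern_a_nonneg by simp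
  have H: "0 < (\<integral>p. pair_density r p \<partial>pos_lborel2)" "0 < (\<integral>p. ww p * kern_a p \<partial>pos_lborel2)"
    unfolding integral_pair_density integral_ww_kern_a by (fact rho2_w_pos lambda_w_sq_pos)+
  \<comment> \<open>The limiting density is placed second, since the bound divides by the second
    mass; the denominator is then independent of r.\<close>
  note * = tv_dist_normalized_densities[OF pair_density_integrable pair_density_nonneg H(1) ww_kern_a_integrable nn H(2)]
  show "0 \<le> tv_dist (Q_w w r) (nu_w w \<Otimes>\<^sub>M nu_w w)"
    "tv_dist (Q_w w r) (nu_w w \<Otimes>\<^sub>M nu_w w) \<le> 2 * Bint r / (lambda_w w)\<^sup>2"
    using * unfolding Q_w_eq nu_w_pair_eq B integral_ww_kern_a by auto
qed

lemma tv_dist_Q_w_Q_w_0: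
  "0 \<le> tv_dist (Q_w w r) (Q_w w 0)"
  "tv_dist (Q_w w r) (Q_w w 0) \<le> 2 * (Bint 0 - Bint r) / rho2_w w 0"
proof -
  have "\<bar>pair_density r p - pair_density 0 p\<bar> = ww p * kern_b 0 p - ww p * kern_b r p" if "p \<in> space pos_lborel2" for p
  proof -
    \<comment> \<open>The difference of the densities has constant sign, so its L1 norm is exactly a
      difference of integrals.\<close>
    have "ww p * kern_b r p \<le> ww p * kern_b 0 p"
      using that ww_nonneg[OF that] kern_b_antimono
      by (cases p) (auto simp: space_pos_lborel2 intro!: mult_left_mono)
    then show ?thesis by (simp add: pair_density_def algebra_simps)
  qed
  then have "(\<integral>p. \<bar>pair_density r p - pair_density 0 p\<bar> \<partial>pos_lborel2)
      = (\<integral>p. ww p * kern_b 0 p - ww p * kern_b r p \<partial>pos_lborel2)"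
    by (intro Bochner_Integration.integral_cong) auto
  then have B: "(\<integral>p. \<bar>pair_density r p - pair_density 0 p\<bar> \<partial>pos_lborel2) = Bint 0 - Bint r"
    unfolding Bint_def using ww_kern_b_integrable by simp
  have H: "0 < (\<integral>p. pair_density s p \<partial>pos_lborel2)" for s
    by (simp add: integral_pair_density rho2_w_pos)
  note * = tv_dist_normalized_densities[OF pair_density_integrable pair_density_nonneg H pair_density_integrable pair_density_nonneg H, of r 0]
  show "0 \<le> tv_dist (Q_w w r) (Q_w w 0)"
    "tv_dist (Q_w w r) (Q_w w 0) \<le> 2 * (Bint 0 - Bint r) / rho2_w w 0"
    using *[unfolded B] unfolding Q_w_eq integral_pair_density by auto
qed

lemma tv_dist_at_infinity: "((\<lambda>r. tv_dist (Q_w w r) (nu_w w \<Otimes>\<^sub>M nu_w w)) \<longlongrightarrow> 0) at_infinity"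
proof (rule tendsto_sandwich[where f = "\<lambda>_. 0"])
  have "((\<lambda>r. 2 * Bint r / (lambda_w w)\<^sup>2) \<longlongrightarrow> 2 * 0 / (lambda_w w)\<^sup>2) at_infinity"
    using lambda_w_sq_pos by (intro tendsto_intros Bint_at_infinity) auto
  then show "((\<lambda>r. 2 * Bint r / (lambda_w w)\<^sup>2) \<longlongrightarrow> 0) at_infinity" by simp
qed (intro tendsto_const always_eventually allI tv_dist_Q_w_nu_w)+

lemma tv_dist_at_0: "((\<lambda>r. tv_dist (Q_w w r) (Q_w w 0)) \<longlongrightarrow> 0) (at 0)"
proof (rule tendsto_sandwich[where f = "\<lambda>_. 0"])
  have "((\<lambda>r. 2 * (Bint 0 - Bint r) / rho2_w w 0) \<longlongrightarrow> 2 * (Bint 0 - Bint 0) / rho2_w w 0) (at 0)"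
    using rho2_w_0_pos by (intro tendsto_intros Bint_at_0) auto
  then show "((\<lambda>r. 2 * (Bint 0 - Bint r) / rho2_w w 0) \<longlongrightarrow> 0) (at 0)" by simp
qed (intro tendsto_const always_eventually allI tv_dist_Q_w_Q_w_0)+

end

theorem corollary3p7:
  fixes \<alpha> \<beta> :: real and w :: "real \<Rightarrow> real"
  assumes "0 < \<alpha>" and "\<alpha> < \<beta>" and "w \<in> W_class \<alpha> \<beta>"
  shows "((\<lambda>r. tv_dist (Q_w w r) (nu_w w \<Otimes>\<^sub>M nu_w w)) \<longlongrightarrow> 0) at_infinity \<and>
    ((\<lambda>r. tv_dist (Q_w w r) (Q_w w 0)) \<longlongrightarrow> 0) (at 0) \<and>
    Q_w w 0 = density (pos_lborel \<Otimes>\<^sub>M pos_lborel)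
      (\<lambda>(y0, y1). ennreal (w y0 * w y1 / rho2_w w 0 *
         (1 / (16 * pi\<^sup>2 * y0\<^sup>2 * y1\<^sup>2) - 1 / (pi\<^sup>2 * (y0 + y1) ^ 4))))"
proof -
  interpret weight \<alpha> \<beta> w by unfold_locales fact+
  show ?thesis
    \<comment> \<open>The density claim is \<open>Q_w_def\<close> at r = 0, with the nested squares
      merged into a fourth power.\<close>
    using tv_dist_at_infinity tv_dist_at_0 by (simp add: Q_w_def flip: power_mult)
qed

end
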